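(* Let $V(x)$ be the ordinary generating function for $2143$-avoiding permutations and let $SV(x)$ be the ordinary generating function for skew-vexillary permutations. Then $$SV(x)=(1-x)V(x)^2-V(x)+\frac1{1-x}.$$
   Context: $\mathfrak S_n$ is the group of permutations of $[n]=\{1,\dots,n\}$, written as words $w=w_1\cdots w_n$. A permutation $w$ is $2143$-avoiding if there are no indices $i<j<k<l$ with $w_j<w_i<w_l<w_k$. The Rothe diagram of $w\in\mathfrak S_n$ is $R_w=\{(i,j)\mid 1\le i,j\le n,\ w(i)>j,\ w^{-1}(j)>i\}$. For a partition $\lambda$, given by integers $n\ge\lambda_1\ge\cdots\ge\lambda_n\ge0$, $S_\lambda=\{(i,j)\mid 1\le i\le n,\ 1\le j\le\lambda_i\}$ (matrix coordinates); a skew shape is a set $S_{\lambda/\mu}=S_\lambda\setminus S_\mu$ with $S_\mu\subseteq S_\lambda$. A permutation $w\in\mathfrak S_n$ is skew-vexillary if there are $\sigma,\tau\in\mathfrak S_n$ and a skew shape $S_{\lambda/\mu}\subseteq[n]\times[n]$ with $\{(\sigma(i),\tau(j))\mid(i,j)\in R_w\}=([n]\times[n])\setminus S_{\lambda/\mu}$. The ordinary generating function of a class of permutations is the formal power series $\sum_{n\ge0}c_nx^n$, where $c_n$ is the number of permutations in $\mathfrak S_n$ in the class; the empty permutation ($n=0$) is included in both classes, so both series have constant term $1$. *)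

theory Defs
  imports "HOL-Computational_Algebra.Formal_Power_Series" "HOL-Combinatorics.Permutations"
begin

text \<open>
  Elements of the symmetric group on \<open>[n]\<close> are functions \<open>w\<close> on the naturals with
  \<open>w permutes {1..n}\<close>. Such a \<open>w\<close> fixes every number outside \<open>{1..n}\<close>, so there is exactly one
  function per permutation. For \<open>n = 0\<close> the only one is the identity, the empty permutation.
\<close>

definition avoids_2143 :: "nat \<Rightarrow> (nat \<Rightarrow> nat) \<Rightarrow> bool" where
  "avoids_2143 n w \<longleftrightarrow>
     \<not> (\<exists>i\<in>{1..n}. \<exists>j\<in>{1..n}. \<exists>k\<in>{1..n}. \<exists>l\<in>{1..n}.
          i < j \<and> j < k \<and> k < l \<and> w j < w i \<and> w i < w l \<and> w l < w k)"

definition rothe_diagram :: "nat \<Rightarrow> (nat \<Rightarrow> nat) \<Rightarrow> (nat \<times> nat) set" where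
  "rothe_diagram n w = {(i, j). i \<in> {1..n} \<and> j \<in> {1..n} \<and> w i > j \<and> inv w j > i}"

text \<open>
  A partition is a function on the naturals of which only the values at \<open>1, \<dots>, n\<close> matter.
\<close>

definition partition_in_square :: "nat \<Rightarrow> (nat \<Rightarrow> nat) \<Rightarrow> bool" where
  "partition_in_square n lam \<longleftrightarrow>
     (\<forall>i\<in>{1..n}. lam i \<le> n) \<and> (\<forall>i\<in>{1..n}. \<forall>j\<in>{1..n}. i \<le> j \<longrightarrow> lam j \<le> lam i)"

definition partition_shape :: "nat \<Rightarrow> (nat \<Rightarrow> nat) \<Rightarrow> (nat \<times> nat) set" where
  "partition_shape n lam = {(i, j). i \<in> {1..n} \<and> 1 \<le> j \<and> j \<le> lam i}"

definition skew_shape :: "nat \<Rightarrow> (nat \<times> nat) set \<Rightarrow> bool" where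
  "skew_shape n S \<longleftrightarrow>
     (\<exists>lam mu. partition_in_square n lam \<and> partition_in_square n mu \<and>
        partition_shape n mu \<subseteq> partition_shape n lam \<and>
        S = partition_shape n lam - partition_shape n mu)"

definition skew_vexillary :: "nat \<Rightarrow> (nat \<Rightarrow> nat) \<Rightarrow> bool" where
  "skew_vexillary n w \<longleftrightarrow>
     (\<exists>\<sigma> \<tau> S. \<sigma> permutes {1..n} \<and> \<tau> permutes {1..n} \<and>
        skew_shape n S \<and> S \<subseteq> {1..n} \<times> {1..n} \<and>
        (\<lambda>(i, j). (\<sigma> i, \<tau> j)) ` rothe_diagram n w = ({1..n} \<times> {1..n}) - S)"

definition perm_class_ogf :: "(nat \<Rightarrow> (nat \<Rightarrow> nat) \<Rightarrow> bool) \<Rightarrow> rat fps" where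
  "perm_class_ogf P = Abs_fps (\<lambda>n. of_nat (card {w. w permutes {1..n} \<and> P n w}))"

end

theory Submission
  imports Defs
begin

text \<open>
  The cells of the Rothe diagram of \<open>w\<close> correspond to the inversions \<open>(p, q)\<close> of \<open>w\<close>, the cell being
  \<open>(p, w q)\<close>. Call two inversions \<open>(p, q)\<close> and \<open>(p', q')\<close> independent if neither \<open>(p, q')\<close> nor
  \<open>(p', q)\<close> is an inversion. An occurrence of 2143 is the same as a pair of independent inversions,
  so \<open>w\<close> avoids 2143 exactly if the columns of its diagram form a chain under inclusion, that is, if
  the diagram is a partition up to permuting rows and columns.

  The complement of a skew shape consists of two partitions, \<open>\<mu>\<close> in the top left corner and a rotated
  one in the bottom right corner. The Rothe diagram always has an empty last row and an empty last
  column. These separate the two corners, so that no row or column meets both, and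
  a connectedness argument on inversions then shows that \<open>w\<close> is skew-vexillary if and only if it is a
  direct sum \<open>u \<oplus> v\<close> of two 2143-avoiding permutations, possibly empty
  (\<open>skew_vexillary_iff_splits\<close>). Call \<open>k\<close> a split of \<open>w\<close> if such a sum exists with \<open>u\<close> of size \<open>k\<close>.

  It remains to count the permutations that have a split. The coefficients of \<open>V\<^sup>2\<close> count pairs of a
  permutation and one of its splits. Those of \<open>x V\<^sup>2\<close> count pairs of a permutation and two consecutive
  splits of it, since these surround a fixed point, as in \<open>u \<oplus> 1 \<oplus> v\<close>. Hence \<open>(1 - x) V\<^sup>2\<close> counts each
  permutation once for each maximal run of consecutive splits. A skew-vexillary permutation that
  contains 2143 has one run, the identity has one run, and every other 2143-avoiding permutation has
  two, one among the fixed points at its beginning and one among those at its end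
  (\<open>card_split_run_ends\<close>). This gives \<open>(1 - x) V\<^sup>2 = SV + V - 1 / (1 - x)\<close>.
\<close>

section \<open>Inversions, patterns and cuts\<close>

abbreviation inversion :: "(nat \<Rightarrow> nat) \<Rightarrow> nat \<Rightarrow> nat \<Rightarrow> bool" where
  "inversion w p q \<equiv> p < q \<and> w q < w p"

text \<open>Avoidance is restricted to a window of positions, so that the summands of a direct sum can be
  tested inside the whole permutation, without renumbering.\<close>

definition avoids_between :: "nat \<Rightarrow> nat \<Rightarrow> (nat \<Rightarrow> nat) \<Rightarrow> bool" where
  "avoids_between a b w \<longleftrightarrow>
     (\<nexists>i j k l. a < i \<and> i < j \<and> j < k \<and> k < l \<and> l \<le> b \<and> w j < w i \<and> w i < w l \<and> w l < w k)"

text \<open>The positions range over all naturals. As a permutation of \<open>{1..n}\<close> fixes \<open>0\<close> and all numbers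
  beyond \<open>n\<close>, this adds no condition for \<open>k \<le> n\<close>, and a cut is a place where \<open>w\<close> decomposes as a direct
  sum.\<close>

definition is_cut :: "(nat \<Rightarrow> nat) \<Rightarrow> nat \<Rightarrow> bool" where
  "is_cut w k \<longleftrightarrow> (\<forall>i j. i \<le> k \<longrightarrow> k < j \<longrightarrow> w i < w j)"

definition splits :: "nat \<Rightarrow> (nat \<Rightarrow> nat) \<Rightarrow> nat set" where
  "splits n w = {k. k \<le> n \<and> is_cut w k \<and> avoids_between 0 k w \<and> avoids_between k n w}"

lemma avoids_betweenD:
  "avoids_between a b w \<Longrightarrow> a < i \<Longrightarrow> i < j \<Longrightarrow> j < k \<Longrightarrow> k < l \<Longrightarrow> l \<le> b \<Longrightarrow>
     w j < w i \<Longrightarrow> w i < w l \<Longrightarrow> w l < w k \<Longrightarrow> False"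
  unfolding avoids_between_def by blast

lemma avoids_2143_iff: "avoids_2143 n w \<longleftrightarrow> avoids_between 0 n w"
proof
  assume av: "avoids_2143 n w"
  show "avoids_between 0 n w"
    unfolding avoids_between_def
  proof (intro notI, elim exE conjE)
    fix i j k l
    assume *: "0 < i" "i < j" "j < k" "k < l" "l \<le> n" "w j < w i" "w i < w l" "w l < w k"
    then have "i \<in> {1..n}" "j \<in> {1..n}" "k \<in> {1..n}" "l \<in> {1..n}"
      by auto
    with * av show False
      unfolding avoids_2143_def by blast
  qed
next
  assume av: "avoids_between 0 n w"
  show "avoids_2143 n w"
    unfolding avoids_2143_def
  proof (intro notI, elim bexE conjE)
    fix i j k l
    assume "i \<in> {1..n}" "l \<in> {1..n}" "i < j" "j < k" "k < l" "w j < w i" "w i < w l" "w l < w k"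
    then show False
      using avoids_betweenD[OF av, of i j k l] by simp
  qed
qed

lemma avoids_between_mono:
  "avoids_between a b w \<Longrightarrow> a \<le> a' \<Longrightarrow> b' \<le> b \<Longrightarrow> avoids_between a' b' w"
  unfolding avoids_between_def using le_less_trans[of a a'] le_trans[of _ b' b] by blast

lemma inversion_range:
  assumes "w permutes {1..n}" "inversion w p q"
  shows "1 \<le> p" "q \<le> n"
proof -
  show "1 \<le> p"
    using assms permutes_not_in[OF assms(1), of 0] by (cases p) auto
  show "q \<le> n"
  proof (rule ccontr)
    assume "\<not> q \<le> n"
    then have "w q = q"
      using permutes_not_in[OF assms(1), of q] by simp
    moreover have "w p \<le> max p n"
      using permutes_not_in[OF assms(1), of p] permutes_in_image[OF assms(1), of p]
      by (cases "p \<in> {1..n}") auto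
    ultimately show False
      using assms(2) \<open>\<not> q \<le> n\<close> by linarith
  qed
qed

text \<open>Whichever of the two positions \<open>p\<close> and \<open>q'\<close> comes first, the two missing
  inversions leave only one relative order of the four positions and values.\<close>

lemma independent_inversions_2143:
  assumes "inj w" "inversion w p q" "inversion w p' q'"
    "\<not> inversion w p q'" "\<not> inversion w p' q"
  shows "(p < q \<and> q < p' \<and> p' < q' \<and> w q < w p \<and> w p < w q' \<and> w q' < w p') \<or>
         (p' < q' \<and> q' < p \<and> p < q \<and> w q' < w p' \<and> w p' < w q \<and> w q < w p)"
proof -
  have neq: "w x = w y \<longleftrightarrow> x = y" for x y
    using assms(1) by (simp add: inj_eq)
  show ?thesis
  proof (cases "p < q'")
    case True
    then have *: "w p < w q'"
      using assms(4) neq[of p q'] by auto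
    then have "w q < w p'"
      using assms(2,3) by linarith
    then have "q < p'"
      using assms(5) by (metis less_irrefl not_less_iff_gr_or_eq)
    then show ?thesis
      using * assms(2,3) by auto
  next
    case False
    then have "p' < q"
      using assms(2,3) by linarith
    then have *: "w p' < w q"
      using assms(5) neq[of p' q] by auto
    then have "p \<noteq> q'"
      using assms(2,3) by auto
    then show ?thesis
      using * False assms(2,3) by auto
  qed
qed

lemma is_cut_iff_image:
  assumes "bij w"
  shows "is_cut w k \<longleftrightarrow> w ` {..k} = {..k}"
proof
  assume cut: "is_cut w k"
  have "inv w ` {..k} = {..k}"
  proof (rule endo_inj_surj)
    show "inv w ` {..k} \<subseteq> {..k}"
    proof (rule ccontr)
      assume "\<not> inv w ` {..k} \<subseteq> {..k}"
      then obtain y where y: "w y \<le> k" "k < y"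
        using bij_inv_eq_iff[OF assms] by (metis atMost_iff image_subsetI not_le)
      \<comment> \<open>The \<open>k + 1\<close> values \<open>w 0, \<dots>, w k\<close> would all lie below \<open>w y \<le> k\<close>.\<close>
      have "w ` {..k} \<subseteq> {..<w y}"
        using cut y unfolding is_cut_def by auto
      then have "card (w ` {..k}) \<le> w y"
        using card_mono[of "{..<w y}"] by auto
      moreover have "card (w ` {..k}) = Suc k"
        using assms by (simp add: card_image bij_is_inj[THEN inj_on_subset])
      ultimately show False
        using y by simp
    qed
    show "inj_on (inv w) {..k}"
      using assms by (metis bij_imp_bij_inv bij_is_inj inj_on_subset subset_UNIV)
  qed simp
  then show "w ` {..k} = {..k}"
    by (metis assms bij_is_surj image_f_inv_f)
next
  assume img: "w ` {..k} = {..k}"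
  show "is_cut w k"
    unfolding is_cut_def
  proof (intro allI impI)
    fix i j
    assume "i \<le> k" "k < j"
    moreover have "w j \<notin> w ` {..k}"
      using \<open>k < j\<close> assms by (auto simp: bij_def inj_eq)
    moreover have "w i \<in> w ` {..k}"
      using \<open>i \<le> k\<close> by simp
    ultimately show "w i < w j"
      unfolding img by simp
  qed
qed

lemma is_cut_le_iff:
  assumes "bij w" "is_cut w k"
  shows "w x \<le> k \<longleftrightarrow> x \<le> k"
proof -
  have "w x \<in> w ` {..k} \<longleftrightarrow> x \<in> {..k}"
    using assms(1) by (simp add: bij_is_inj inj_image_mem_iff)
  then show ?thesis
    using assms is_cut_iff_image by auto
qed

lemma is_cut_no_crossing:
  "is_cut w k \<Longrightarrow> inversion w i j \<Longrightarrow> j \<le> k \<or> k < i"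
  unfolding is_cut_def by (meson not_less less_asym)

lemma not_is_cutE:
  assumes "inj w" "\<not> is_cut w k"
  obtains i j where "i \<le> k" "k < j" "inversion w i j"
proof -
  from assms obtain i j where ij: "i \<le> k" "k < j" "\<not> w i < w j"
    unfolding is_cut_def by auto
  then have "w i \<noteq> w j"
    using assms(1) by (auto simp: inj_eq)
  with ij that show ?thesis
    by auto
qed

lemma is_cut_0:
  assumes "w permutes {1..n}"
  shows "is_cut w 0"
proof (rule ccontr)
  assume "\<not> is_cut w 0"
  then obtain i j where "i \<le> 0" "inversion w i j"
    using not_is_cutE[OF permutes_inj[OF assms]] by metis
  then show False
    using inversion_range(1)[OF assms, of i j] by simp
qed

lemma is_cut_n:
  assumes "w permutes {1..n}"
  shows "is_cut w n"
proof (rule ccontr)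
  assume "\<not> is_cut w n"
  then obtain i j where "n < j" "inversion w i j"
    using not_is_cutE[OF permutes_inj[OF assms]] by metis
  then show False
    using inversion_range(2)[OF assms, of i j] by simp
qed


section \<open>Skew-vexillary permutations are sums of two 2143-avoiding ones\<close>

lemma rothe_diagram_iff:
  assumes "w permutes {1..n}"
  shows "(p, w q) \<in> rothe_diagram n w \<longleftrightarrow> inversion w p q"
proof -
  have inv: "inv w (w q) = q"
    using assms by (simp add: permutes_inverses)
  show ?thesis
  proof
    assume "inversion w p q"
    moreover from this have "1 \<le> p" "q \<le> n"
      using inversion_range[OF assms] by auto
    moreover from calculation have "w q \<in> {1..n}"
      using permutes_in_image[OF assms, of q] by auto
    ultimately show "(p, w q) \<in> rothe_diagram n w"
      using inv by (auto simp: rothe_diagram_def)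
  qed (auto simp: rothe_diagram_def inv)
qed

lemma rothe_diagram_memD:
  assumes "w permutes {1..n}" "(i, j) \<in> rothe_diagram n w"
  shows "inversion w i (inv w j)" "i \<in> {1..n}" "j \<in> {1..n}"
  using assms rothe_diagram_iff[OF assms(1), of i "inv w j"]
  by (auto simp: permutes_inverses rothe_diagram_def)

text \<open>Colour a cell of the diagram by whether it is carried into \<open>\<mu>\<close> or to the outside of \<open>\<lambda>\<close>. Row \<open>n\<close>
  and column \<open>n\<close> of the diagram are empty, so the skew shape contains a full row and a full column.
  A row that meets \<open>\<mu>\<close> lies above the full row and a row that leaves \<open>\<lambda>\<close> lies below it, hence no row
  has both colours; in the same way columns are kept apart by the full column. Within one colour
  there are no independent inversions, since the rows of a partition are nested.\<close>

lemma skew_vexillary_colouring: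
  assumes w: "w permutes {1..n}" and sv: "skew_vexillary n w"
  obtains f :: "nat \<Rightarrow> nat \<Rightarrow> bool" where
    "\<And>p q q'. inversion w p q \<Longrightarrow> inversion w p q' \<Longrightarrow> f p q = f p q'"
    "\<And>p p' q. inversion w p q \<Longrightarrow> inversion w p' q \<Longrightarrow> f p q = f p' q"
    "\<And>p q p' q'. inversion w p q \<Longrightarrow> inversion w p' q' \<Longrightarrow> f p q = f p' q' \<Longrightarrow>
       inversion w p q' \<or> inversion w p' q"
proof -
  let ?N = "{1..n}"
  from sv obtain \<sigma> \<tau> lam mu where \<sigma>: "\<sigma> permutes ?N" and \<tau>: "\<tau> permutes ?N"
    and lam: "partition_in_square n lam" and mu: "partition_in_square n mu"
    and img: "(\<lambda>(i, j). (\<sigma> i, \<tau> j)) ` rothe_diagram n w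
      = (?N \<times> ?N) - (partition_shape n lam - partition_shape n mu)"
    unfolding skew_vexillary_def skew_shape_def by blast
  have s_in: "\<sigma> i \<in> ?N \<longleftrightarrow> i \<in> ?N" and t_in: "\<tau> i \<in> ?N \<longleftrightarrow> i \<in> ?N" for i
    using permutes_in_image \<sigma> \<tau> by metis+
  have inj: "inj (\<lambda>(i, j). (\<sigma> i, \<tau> j))"
    by (rule injI) (auto dest: injD[OF permutes_inj[OF \<sigma>]] injD[OF permutes_inj[OF \<tau>]])
  have cell: "(i, j) \<in> rothe_diagram n w \<longleftrightarrow> \<tau> j \<le> mu (\<sigma> i) \<or> lam (\<sigma> i) < \<tau> j"
    if "i \<in> ?N" "j \<in> ?N" for i j
  proof -
    have "(i, j) \<in> rothe_diagram n w \<longleftrightarrow>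
        (\<sigma> i, \<tau> j) \<in> (\<lambda>(i, j). (\<sigma> i, \<tau> j)) ` rothe_diagram n w"
      using inj_image_mem_iff[OF inj, of "(i, j)"] by simp
    moreover have "\<sigma> i \<in> ?N" "\<tau> j \<in> ?N"
      using that s_in t_in by auto
    ultimately show ?thesis
      unfolding img partition_shape_def by auto
  qed
  have lam_mono: "lam y \<le> lam x" and mu_mono: "mu y \<le> mu x" if "x \<in> ?N" "y \<in> ?N" "x \<le> y" for x y
    using lam mu that unfolding partition_in_square_def by auto
  define f where "f p q \<longleftrightarrow> \<tau> (w q) \<le> mu (\<sigma> p)" for p q
  have range: "p \<in> ?N" "q \<in> ?N" "w q \<in> ?N" "\<sigma> p \<in> ?N" "\<tau> (w q) \<in> ?N" if "inversion w p q" for p q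
    using inversion_range[OF w that] that s_in t_in permutes_in_image[OF w, of q] by auto
  have out: "lam (\<sigma> p) < \<tau> (w q)" if "inversion w p q" "\<not> f p q" for p q
    using that range[OF that(1)] cell[of p "w q"] rothe_diagram_iff[OF w, of p q]
    unfolding f_def by blast
  have row: "f p q'" if *: "inversion w p q" "inversion w p q'" "f p q" for p q q'
  proof (rule ccontr)
    assume n: "\<not> f p q'"
    have n1: "n \<in> ?N"
      using range[OF *(1)] by auto
    then have tn: "inv \<tau> n \<in> ?N" "inv \<tau> 1 \<in> ?N"
      using permutes_in_image[OF permutes_inv[OF \<tau>]] by auto
    have empty: "(n, j) \<notin> rothe_diagram n w" for j
      using rothe_diagram_memD[OF w, of n j] inversion_range[OF w, of n "inv w j"] by auto
    have "mu (\<sigma> n) < 1" "n \<le> lam (\<sigma> n)"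
      using cell[OF n1 tn(2)] cell[OF n1 tn(1)] empty by (auto simp: permutes_inverses[OF \<tau>])
    moreover have "\<tau> (w q) \<le> mu (\<sigma> p)" "lam (\<sigma> p) < \<tau> (w q')"
      using *(3) out[OF *(2) n] unfolding f_def by auto
    moreover have "\<tau> (w q) \<ge> 1" "\<tau> (w q') \<le> n" "\<sigma> p \<in> ?N" "\<sigma> n \<in> ?N"
      using range[OF *(1)] range[OF *(2)] n1 s_in by auto
    ultimately show False
      using lam_mono[of "\<sigma> p" "\<sigma> n"] mu_mono[of "\<sigma> n" "\<sigma> p"] by linarith
  qed
  have col: "f p' q" if *: "inversion w p q" "inversion w p' q" "f p q" for p p' q
  proof (rule ccontr)
    assume n: "\<not> f p' q"
    have n1: "n \<in> ?N"
      using range[OF *(1)] by auto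
    have empty: "(i, n) \<notin> rothe_diagram n w" for i
    proof
      assume "(i, n) \<in> rothe_diagram n w"
      then have "n < w i" "i \<in> ?N"
        by (auto simp: rothe_diagram_def)
      then show False
        using permutes_in_image[OF w, of i] by auto
    qed
    have "mu (\<sigma> p) < \<tau> n" "\<tau> n \<le> lam (\<sigma> p')"
      using cell[OF _ n1] empty range[OF *(1)] range[OF *(2)] by (auto simp: not_le not_less)
    moreover have "\<tau> (w q) \<le> mu (\<sigma> p)" "lam (\<sigma> p') < \<tau> (w q)"
      using *(3) out[OF *(2) n] unfolding f_def by auto
    ultimately show False
      by linarith
  qed
  have nested: "inversion w p q' \<or> inversion w p' q"
    if *: "inversion w p q" "inversion w p' q'" "f p q = f p' q'" "\<sigma> p \<le> \<sigma> p'" for p q p' q'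
  proof -
    note r = range[OF *(1)] range[OF *(2)]
    have mono: "lam (\<sigma> p') \<le> lam (\<sigma> p)" "mu (\<sigma> p') \<le> mu (\<sigma> p)"
      using lam_mono mu_mono r *(4) by auto
    show ?thesis
    proof (cases "f p q")
      case True
      then have "\<tau> (w q') \<le> mu (\<sigma> p)"
        using *(3) mono unfolding f_def by simp
      then show ?thesis
        using cell[of p "w q'"] r rothe_diagram_iff[OF w] by blast
    next
      case False
      then have "lam (\<sigma> p') < \<tau> (w q)"
        using out[OF *(1)] mono by simp
      then show ?thesis
        using cell[of p' "w q"] r rothe_diagram_iff[OF w] by blast
    qed
  qed
  show ?thesis
  proof (rule that)
    show "f p q = f p q'" if "inversion w p q" "inversion w p q'" for p q q'
      using row[OF that] row[OF that(2,1)] by blast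
    show "f p q = f p' q" if "inversion w p q" "inversion w p' q" for p p' q
      using col[OF that] col[OF that(2,1)] by blast
    show "inversion w p q' \<or> inversion w p' q"
      if "inversion w p q" "inversion w p' q'" "f p q = f p' q'" for p q p' q'
      using nested[OF that] nested[OF that(2,1) that(3)[symmetric]] by linarith
  qed
qed

text \<open>If only one colour occurs, \<open>w\<close> avoids 2143 and \<open>0\<close> is a split. Otherwise, if \<open>(p, q)\<close> and \<open>(q, r)\<close> are inversions, so is \<open>(p, r)\<close>, and it shares a row with the first
  and a column with the second. Hence every position meets only one colour, and no inversion joins
  positions of different colours. If \<open>b\<close> is the first position that meets the second colour, the
  cut is therefore just before \<open>b\<close>; nestedness keeps the first colour to the left of it.\<close>

lemma colouring_imp_splits:
  fixes f :: "nat \<Rightarrow> nat \<Rightarrow> bool"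
  assumes w: "w permutes {1..n}"
    and row: "\<And>p q q'. inversion w p q \<Longrightarrow> inversion w p q' \<Longrightarrow> f p q = f p q'"
    and col: "\<And>p p' q. inversion w p q \<Longrightarrow> inversion w p' q \<Longrightarrow> f p q = f p' q"
    and nested: "\<And>p q p' q'. inversion w p q \<Longrightarrow> inversion w p' q' \<Longrightarrow> f p q = f p' q' \<Longrightarrow>
       inversion w p q' \<or> inversion w p' q"
  shows "splits n w \<noteq> {}"
proof -
  have inj: "inj w"
    using w by (rule permutes_inj)
  have avoid: "avoids_between a b w"
    if "\<And>p q. inversion w p q \<Longrightarrow> a < p \<Longrightarrow> q \<le> b \<Longrightarrow> f p q = c" for a b c
    unfolding avoids_between_def
  proof (intro notI, elim exE conjE)
    fix i j k l
    assume *: "a < i" "i < j" "j < k" "k < l" "l \<le> b" "w j < w i" "w i < w l" "w l < w k"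
    then have "f i j = f k l"
      using that[of i j] that[of k l] by simp
    with nested[of i j k l] * show False
      by linarith
  qed
  define meets where
    "meets c p \<longleftrightarrow> (\<exists>q. inversion w p q \<and> f p q = c \<or> inversion w q p \<and> f q p = c)" for c p
  have meetsI: "meets c p" "meets c q" if "inversion w p q" "f p q = c" for c p q
    using that unfolding meets_def by auto
  have path: "f p q = f q r" if "inversion w p q" "inversion w q r" for p q r
  proof -
    have "inversion w p r"
      using that by linarith
    then show ?thesis
      using row[OF that(1)] col[OF that(2)] by metis
  qed
  have one: "c = d" if "meets c p" "meets d p" for c d p
    using that unfolding meets_def by (metis path row col)
  have main: "splits n w \<noteq> {}"
    if ab: "meets c a" "meets (\<not> c) b" "a < b" "\<forall>p<b. \<not> meets (\<not> c) p" for a b c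
  proof -
    have b: "1 \<le> b" "b \<le> n"
      using ab(2) inversion_range[OF w] unfolding meets_def by (meson less_imp_le order_trans)+
    have before: "f i j = c" if "inversion w i j" "i < b" for i j
      using meetsI(1)[OF that(1) refl] ab(4) that(2) by (cases "f i j = c") auto
    \<comment> \<open>An inversion \<open>(i, j)\<close> across the cut has the first colour, so \<open>(b, j)\<close> is not an inversion. But
      then \<open>w i > w j > w b\<close>, and the inversion \<open>(i, b)\<close> joins the two colours.\<close>
    have cut: "is_cut w (b - 1)"
    proof (rule ccontr)
      assume "\<not> is_cut w (b - 1)"
      then obtain i j where "i \<le> b - 1" "b - 1 < j" and ij: "inversion w i j"
        using not_is_cutE[OF inj] by metis
      then have i: "i < b" and j: "b \<le> j"
        using b by auto
      have fij: "f i j = c"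
        using before ij i by blast
      then have "j \<noteq> b"
        using one[of c b "\<not> c"] ab(2) meetsI(2)[OF ij] by auto
      have "\<not> inversion w b j"
        using one[of c b "\<not> c"] ab(2) col[OF ij, of b] fij meetsI(1)[of b j c] by auto
      then have "inversion w i b"
        using j \<open>j \<noteq> b\<close> i ij by linarith
      then have "meets c b"
        using before i meetsI(2) by blast
      then show False
        using one[of c b "\<not> c"] ab(2) by auto
    qed
    obtain x y where xy: "inversion w x y" "f x y = c" "x < b"
      using ab(1,3) unfolding meets_def by (meson less_trans)
    then have "y \<le> b - 1"
      using is_cut_no_crossing[OF cut xy(1)] b by auto
    \<comment> \<open>A second-block inversion of the first colour would be independent of \<open>(x, y)\<close>.\<close>
    have after: "f i j = (\<not> c)" if ij: "inversion w i j" "b - 1 < i" for i j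
    proof (rule ccontr)
      assume "f i j \<noteq> (\<not> c)"
      then have "inversion w x j \<or> inversion w i y"
        using nested[OF xy(1) ij(1)] xy(2) by auto
      then show False
        using is_cut_no_crossing[OF cut, of x j] is_cut_no_crossing[OF cut, of i y]
          \<open>y \<le> b - 1\<close> ij xy(1) by linarith
    qed
    have "avoids_between 0 (b - 1) w"
      by (rule avoid[of _ _ c], rule before) (use b in auto)
    moreover have "avoids_between (b - 1) n w"
      by (rule avoid[of _ _ "\<not> c"], rule after) auto
    ultimately have "b - 1 \<in> splits n w"
      using cut b unfolding splits_def by auto
    then show ?thesis
      by blast
  qed
  show ?thesis
  proof (cases "\<exists>c. \<forall>p q. inversion w p q \<longrightarrow> f p q = c")
    case True
    then obtain c where "\<And>p q. inversion w p q \<Longrightarrow> f p q = c"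
      by blast
    then have "avoids_between 0 n w"
      using avoid[of 0 n c] by blast
    moreover have "avoids_between 0 0 w"
      unfolding avoids_between_def by auto
    ultimately have "0 \<in> splits n w"
      using is_cut_0[OF w] unfolding splits_def by auto
    then show ?thesis
      by blast
  next
    case False
    have ex: "\<exists>p. meets c p" for c
    proof -
      have "\<not> (\<forall>p q. inversion w p q \<longrightarrow> f p q = (\<not> c))"
      proof
        assume "\<forall>p q. inversion w p q \<longrightarrow> f p q = (\<not> c)"
        then have "\<exists>c. \<forall>p q. inversion w p q \<longrightarrow> f p q = c"
          by (rule exI)
        with False show False ..
      qed
      then obtain p q where "inversion w p q" "f p q \<noteq> (\<not> c)"
        by auto
      then show ?thesis
        using meetsI(1)[of p q c] by auto
    qed
    define first where "first c = (LEAST p. meets c p)" for c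
    have first: "meets c (first c)" "\<forall>p<first c. \<not> meets c p" for c
      using LeastI_ex[OF ex] not_less_Least unfolding first_def by blast+
    have "first True \<noteq> first False"
      using one[of True "first True" False] first(1)[of True] first(1)[of False] by auto
    then consider "first True < first (\<not> True)" | "first False < first (\<not> False)"
      by (metis (full_types) linorder_neqE_nat)
    then show ?thesis
    proof cases
      case 1
      then show ?thesis
        using main[OF first(1) first(1) _ first(2)] by blast
    next
      case 2
      then show ?thesis
        using main[OF first(1) first(1) _ first(2)] by blast
    qed
  qed
qed


section \<open>Sums of two 2143-avoiding permutations are skew-vexillary\<close>

lemma sorting_permutation:
  fixes h :: "nat \<Rightarrow> int"
  shows "\<exists>\<tau>. \<tau> permutes {1..n} \<and> (\<forall>i\<in>{1..n}. \<forall>j\<in>{1..n}. \<tau> i \<le> \<tau> j \<longrightarrow> h i \<le> h j)"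
proof -
  \<comment> \<open>The rank of \<open>j\<close> in the order by \<open>h\<close>, with ties broken by position.\<close>
  define before where "before j = {i \<in> {1..n}. h i < h j \<or> h i = h j \<and> i \<le> j}" for j
  define \<tau> where "\<tau> j = (if j \<in> {1..n} then card (before j) else j)" for j
  have less: "card (before i) < card (before j)"
    if "i \<in> {1..n}" "j \<in> {1..n}" "h i < h j \<or> h i = h j \<and> i < j" for i j
  proof (rule psubset_card_mono)
    have "j \<in> before j" "j \<notin> before i" "before i \<subseteq> before j"
      using that unfolding before_def by auto
    then show "before i \<subset> before j"
      by blast
  qed (simp add: before_def)
  show ?thesis
  proof (intro exI conjI ballI impI)
    show "\<tau> permutes {1..n}"
    proof (rule inj_imp_permutes)
      show "inj_on \<tau> {1..n}"
      proof (rule inj_onI)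
        fix i j assume ij: "i \<in> {1..n}" "j \<in> {1..n}" "\<tau> i = \<tau> j"
        then show "i = j"
          using less[of i j] less[of j i] unfolding \<tau>_def
          by (metis less_irrefl linorder_neqE)
      qed
      show "\<tau> j \<in> {1..n}" if "j \<in> {1..n}" for j
      proof -
        have "j \<in> before j" "finite (before j)"
          using that unfolding before_def by auto
        then have "card (before j) > 0"
          by (auto simp: card_gt_0_iff)
        moreover have "card (before j) \<le> card {1..n}"
          by (rule card_mono) (auto simp: before_def)
        ultimately show ?thesis
          using that unfolding \<tau>_def by auto
      qed
    qed (auto simp: \<tau>_def)
    show "h i \<le> h j" if "i \<in> {1..n}" "j \<in> {1..n}" "\<tau> i \<le> \<tau> j" for i j
      using that less[of j i] unfolding \<tau>_def by (metis not_le)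
  qed
qed

lemma down_closed_eq_atLeastAtMost:
  assumes "D \<subseteq> {1..n}" "\<And>x y. x \<in> D \<Longrightarrow> y \<in> {1..n} \<Longrightarrow> y < x \<Longrightarrow> y \<in> D"
  shows "D = {1..card D}"
proof (cases "D = {}")
  case False
  have fin: "finite D"
    using assms(1) finite_subset by blast
  have "D = {1..Max D}"
  proof
    show "D \<subseteq> {1..Max D}"
      using fin assms(1) by auto
    show "{1..Max D} \<subseteq> D"
    proof
      fix y assume "y \<in> {1..Max D}"
      moreover have "Max D \<in> D"
        using fin False by simp
      ultimately show "y \<in> D"
        using assms(1) assms(2)[of "Max D" y] by (cases "y = Max D") auto
    qed
  qed
  then show ?thesis
    by (metis card_atLeastAtMost diff_Suc_1)
qed simp

lemma up_closed_eq_greaterThanAtMost: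
  assumes "D \<subseteq> {1..n}" "\<And>x y. x \<in> D \<Longrightarrow> y \<in> {1..n} \<Longrightarrow> x < y \<Longrightarrow> y \<in> D"
  shows "D = {n - card D<..n}"
proof -
  have "{1..n} - D = {1..card ({1..n} - D)}"
    by (rule down_closed_eq_atLeastAtMost[of _ n]) (use assms(2) in blast)+
  moreover have "card ({1..n} - D) = n - card D"
    using assms(1) by (simp add: card_Diff_subset finite_subset)
  ultimately have "{1..n} - D = {1..n - card D}"
    by simp
  moreover have "D = {1..n} - ({1..n} - D)"
    using assms(1) by blast
  ultimately have "D = {1..n} - {1..n - card D}"
    by metis
  also have "\<dots> = {n - card D<..n}"
    by auto
  finally show ?thesis .
qed

text \<open>Two columns that are not nested give independent inversions, hence the pattern.\<close>

lemma columns_nested: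
  assumes inj: "inj w" and av: "avoids_between a b w"
    and in1: "\<And>p. inversion w p q \<Longrightarrow> a < p \<and> q \<le> b"
    and in2: "\<And>p. inversion w p q' \<Longrightarrow> a < p \<and> q' \<le> b"
  shows "{p. inversion w p q} \<subseteq> {p. inversion w p q'} \<or> {p. inversion w p q'} \<subseteq> {p. inversion w p q}"
proof (rule ccontr)
  assume "\<not> ?thesis"
  then obtain p p' where "inversion w p q" "inversion w p' q'" "\<not> inversion w p q'" "\<not> inversion w p' q"
    by auto
  with independent_inversions_2143[OF inj this] in1[of p] in2[of p'] show False
    using avoids_betweenD[OF av, of p q p' q'] avoids_betweenD[OF av, of p' q' p q] by auto
qed

text \<open>Sort the rows and the columns by signed size, negative before the cut and positive after it.
  The rows of the first block then form a partition in the top left corner, those of the second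
  block the complement of a partition in the bottom right corner, and the empty ones lie between.\<close>

lemma splits_imp_skew_vexillary:
  assumes w: "w permutes {1..n}" and k: "k \<in> splits n w"
  shows "skew_vexillary n w"
proof -
  let ?N = "{1..n}"
  let ?R = "rothe_diagram n w"
  have cut: "is_cut w k" and av1: "avoids_between 0 k w" and av2: "avoids_between k n w"
    using k unfolding splits_def by auto
  have inj: "inj w" and bij: "bij w"
    using w permutes_inj permutes_bij by blast+
  have below: "inv w j \<le> k \<longleftrightarrow> j \<le> k" for j
    using is_cut_le_iff[OF bij cut, of "inv w j"] by (simp add: permutes_inverses[OF w])
  have cell: "(i, j) \<in> ?R \<longleftrightarrow> inversion w i (inv w j)" for i j
    using rothe_diagram_iff[OF w, of i "inv w j"] by (simp add: permutes_inverses[OF w])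
  have side: "i \<le> k \<longleftrightarrow> j \<le> k" if "(i, j) \<in> ?R" for i j
    using is_cut_no_crossing[OF cut, of i "inv w j"] that below[of j] unfolding cell by linarith
  define row col where "row i = {j. (i, j) \<in> ?R}" and "col j = {i. (i, j) \<in> ?R}" for i j
  have sub: "row i \<subseteq> ?N" "col i \<subseteq> ?N" for i
    unfolding row_def col_def rothe_diagram_def by auto
  have fin: "finite (row i)" "finite (col i)" for i
    using finite_subset[OF sub(1)] finite_subset[OF sub(2)] by simp_all
  have card_row: "card (row i) \<le> n" for i
    using card_mono[OF _ sub(1)] by simp
  have nested: "col j \<subseteq> col j' \<or> col j' \<subseteq> col j" if "j \<le> k \<longleftrightarrow> j' \<le> k" for j j'
  proof (cases "j \<le> k")
    case True
    then show ?thesis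
      using columns_nested[OF inj av1, of "inv w j" "inv w j'"] that below[of j] below[of j']
        inversion_range(1)[OF w]
      unfolding col_def cell by (metis (no_types, lifting) Suc_le_eq One_nat_def)
  next
    case False
    have "k < p \<and> inv w x \<le> n" if "inversion w p (inv w x)" "\<not> x \<le> k" for x p
      using side[of p x] cell that inversion_range[OF w that(1)] by auto
    then show ?thesis
      using columns_nested[OF inj av2, of "inv w j" "inv w j'"] that False
      unfolding col_def cell by (metis (no_types, lifting))
  qed
  have col_le: "col j \<subseteq> col j'" if "j \<le> k \<longleftrightarrow> j' \<le> k" "card (col j) \<le> card (col j')" for j j'
    using nested[OF that(1)] card_seteq[OF fin(2)[of j], of "col j'"] that(2) by blast
  define g h where "g i = (if i \<le> k then - int (card (row i)) else int (card (row i)))"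
    and "h j = (if j \<le> k then - int (card (col j)) else int (card (col j)))" for i j
  obtain \<sigma> where \<sigma>: "\<sigma> permutes ?N"
    and \<sigma>_sort: "\<And>i j. i \<in> ?N \<Longrightarrow> j \<in> ?N \<Longrightarrow> \<sigma> i \<le> \<sigma> j \<Longrightarrow> g i \<le> g j"
    using sorting_permutation[of n g] by metis
  obtain \<tau> where \<tau>: "\<tau> permutes ?N"
    and \<tau>_sort: "\<And>i j. i \<in> ?N \<Longrightarrow> j \<in> ?N \<Longrightarrow> \<tau> i \<le> \<tau> j \<Longrightarrow> h i \<le> h j"
    using sorting_permutation[of n h] by metis
  have nonempty: "card (col j) > 0" if "(i, j) \<in> ?R" for i j
    using that fin(2)[of j] by (auto simp: card_gt_0_iff col_def)
  have \<tau>_in: "\<tau> j \<in> ?N \<longleftrightarrow> j \<in> ?N" for j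
    using permutes_in_image[OF \<tau>] .
  have \<tau>_row: "\<tau> ` row i \<subseteq> ?N" "card (\<tau> ` row i) = card (row i)" for i
    using sub(1)[of i] \<tau>_in permutes_inj_on[OF \<tau>] by (auto simp: card_image)
  have row_upper: "\<tau> ` row i = {1..card (row i)}" if "i \<le> k" for i
  proof -
    have "y \<in> \<tau> ` row i" if "x \<in> \<tau> ` row i" "y \<in> ?N" "y < x" for x y
    proof -
      obtain j where j: "x = \<tau> j" "(i, j) \<in> ?R"
        using \<open>x \<in> \<tau> ` row i\<close> unfolding row_def by auto
      obtain j' where j': "y = \<tau> j'" "j' \<in> ?N"
        using \<open>y \<in> ?N\<close> permutes_image[OF \<tau>] by blast
      have "j \<in> ?N"
        using rothe_diagram_memD[OF w j(2)] by simp
      then have "h j' \<le> h j"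
        using \<tau>_sort j j' \<open>y < x\<close> by simp
      moreover have "j \<le> k"
        using side[OF j(2)] \<open>i \<le> k\<close> by simp
      ultimately have "j' \<le> k" "card (col j) \<le> card (col j')"
        using nonempty[OF j(2)] unfolding h_def by (auto split: if_splits)
      then have "i \<in> col j'"
        using col_le[of j j'] \<open>j \<le> k\<close> j(2) unfolding col_def by auto
      then show ?thesis
        using j' unfolding col_def row_def by auto
    qed
    from down_closed_eq_atLeastAtMost[OF \<tau>_row(1) this] show ?thesis
      by (simp add: \<tau>_row(2))
  qed
  have row_lower: "\<tau> ` row i = {n - card (row i)<..n}" if "k < i" for i
  proof -
    have "y \<in> \<tau> ` row i" if "x \<in> \<tau> ` row i" "y \<in> ?N" "x < y" for x y
    proof -
      obtain j where j: "x = \<tau> j" "(i, j) \<in> ?R"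
        using \<open>x \<in> \<tau> ` row i\<close> unfolding row_def by auto
      obtain j' where j': "y = \<tau> j'" "j' \<in> ?N"
        using \<open>y \<in> ?N\<close> permutes_image[OF \<tau>] by blast
      have "j \<in> ?N"
        using rothe_diagram_memD[OF w j(2)] by simp
      then have "h j \<le> h j'"
        using \<tau>_sort j j' \<open>x < y\<close> by simp
      moreover have "\<not> j \<le> k"
        using side[OF j(2)] \<open>k < i\<close> by simp
      ultimately have "\<not> j' \<le> k" "card (col j) \<le> card (col j')"
        using nonempty[OF j(2)] unfolding h_def by (auto split: if_splits)
      then have "i \<in> col j'"
        using col_le[of j j'] \<open>\<not> j \<le> k\<close> j(2) unfolding col_def by auto
      then show ?thesis
        using j' unfolding col_def row_def by auto
    qed
    from up_closed_eq_greaterThanAtMost[OF \<tau>_row(1) this] show ?thesis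
      by (simp add: \<tau>_row(2))
  qed
  define mu lam where "mu x = nat (- g (inv \<sigma> x))" and "lam x = n - nat (g (inv \<sigma> x))" for x
  have g_le: "nat (- g i) + nat (g i) \<le> n" for i
    using card_row[of i] unfolding g_def by auto
  have sorted: "g (inv \<sigma> x) \<le> g (inv \<sigma> y)" if "x \<in> ?N" "y \<in> ?N" "x \<le> y" for x y
    using that \<sigma>_sort[of "inv \<sigma> x" "inv \<sigma> y"] permutes_in_image[OF permutes_inv[OF \<sigma>]]
    by (simp add: permutes_inverses[OF \<sigma>])
  have part: "partition_in_square n lam" "partition_in_square n mu"
    unfolding partition_in_square_def
  proof (safe)
    fix x assume "x \<in> ?N"
    show "lam x \<le> n"
      unfolding lam_def by simp
    show "mu x \<le> n"
      using g_le[of "inv \<sigma> x"] unfolding mu_def by simp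
  next
    fix x y assume "x \<in> ?N" "y \<in> ?N" "x \<le> y"
    from sorted[OF this] show "lam y \<le> lam x" "mu y \<le> mu x"
      unfolding lam_def mu_def by auto
  qed
  have "partition_shape n mu \<subseteq> partition_shape n lam"
    using g_le unfolding partition_shape_def mu_def lam_def
    by (auto intro!: order_trans[OF _ add_le_imp_le_diff])
  define S where "S = partition_shape n lam - partition_shape n mu"
  have shape: "skew_shape n S"
    unfolding skew_shape_def S_def
    using part \<open>partition_shape n mu \<subseteq> partition_shape n lam\<close> by blast
  have "lam x \<le> n" for x
    unfolding lam_def by simp
  then have "S \<subseteq> ?N \<times> ?N"
    unfolding S_def partition_shape_def using le_trans[of _ "lam _" n] by auto
  have mem: "(i, j) \<in> ?R \<longleftrightarrow> (\<sigma> i, \<tau> j) \<notin> S" if ij: "i \<in> ?N" "j \<in> ?N" for i j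
  proof -
    have "(i, j) \<in> ?R \<longleftrightarrow> \<tau> j \<in> \<tau> ` row i"
      using permutes_inj[OF \<tau>] by (simp add: inj_image_mem_iff row_def)
    also have "\<dots> \<longleftrightarrow> \<tau> j \<le> mu (\<sigma> i) \<or> lam (\<sigma> i) < \<tau> j"
      using row_upper[of i] row_lower[of i] \<tau>_in[of j] ij
      unfolding mu_def lam_def g_def permutes_inverses(2)[OF \<sigma>] by (cases "i \<le> k") auto
    also have "\<dots> \<longleftrightarrow> (\<sigma> i, \<tau> j) \<notin> S"
      using ij \<tau>_in[of j] permutes_in_image[OF \<sigma>, of i] unfolding S_def partition_shape_def by auto
    finally show ?thesis .
  qed
  have "(\<lambda>(i, j). (\<sigma> i, \<tau> j)) ` ?R = (?N \<times> ?N) - S"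
  proof (intro equalityI subsetI)
    fix z assume "z \<in> (\<lambda>(i, j). (\<sigma> i, \<tau> j)) ` ?R"
    then obtain i j where "z = (\<sigma> i, \<tau> j)" "(i, j) \<in> ?R"
      by auto
    moreover from this have "i \<in> ?N" "j \<in> ?N"
      using rothe_diagram_memD(2,3)[OF w, of i j] by blast+
    ultimately show "z \<in> (?N \<times> ?N) - S"
      using mem[of i j] permutes_in_image[OF \<sigma>, of i] \<tau>_in[of j] by blast
  next
    fix z assume z: "z \<in> (?N \<times> ?N) - S"
    then have "z \<in> (\<sigma> ` ?N) \<times> (\<tau> ` ?N)"
      unfolding permutes_image[OF \<sigma>] permutes_image[OF \<tau>] by blast
    then obtain i j where ij: "z = (\<sigma> i, \<tau> j)" "i \<in> ?N" "j \<in> ?N"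
      by blast
    then have "(i, j) \<in> ?R"
      using mem[of i j] z by blast
    with ij(1) show "z \<in> (\<lambda>(i, j). (\<sigma> i, \<tau> j)) ` ?R"
      by (auto intro: rev_image_eqI)
  qed
  then show ?thesis
    unfolding skew_vexillary_def using \<sigma> \<tau> shape \<open>S \<subseteq> ?N \<times> ?N\<close> by blast
qed

theorem skew_vexillary_iff_splits:
  assumes "w permutes {1..n}"
  shows "skew_vexillary n w \<longleftrightarrow> splits n w \<noteq> {}"
proof
  assume "skew_vexillary n w"
  then obtain f :: "nat \<Rightarrow> nat \<Rightarrow> bool" where
    "\<And>p q q'. inversion w p q \<Longrightarrow> inversion w p q' \<Longrightarrow> f p q = f p q'"
    "\<And>p p' q. inversion w p q \<Longrightarrow> inversion w p' q \<Longrightarrow> f p q = f p' q"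
    "\<And>p q p' q'. inversion w p q \<Longrightarrow> inversion w p' q' \<Longrightarrow> f p q = f p' q' \<Longrightarrow>
       inversion w p q' \<or> inversion w p' q"
    by (rule skew_vexillary_colouring[OF assms]) blast
  then show "splits n w \<noteq> {}"
    by (rule colouring_imp_splits[OF assms])
qed (use splits_imp_skew_vexillary[OF assms] in blast)

section \<open>Enumerating the permutations with prescribed cuts\<close>

definition avoiders :: "nat \<Rightarrow> nat \<Rightarrow> (nat \<Rightarrow> nat) set" where
  "avoiders a b = {v. v permutes {a<..b} \<and> avoids_between a b v}"

lemma avoids_between_shift:
  assumes "\<And>x. v (x + a) = w x + a"
  shows "avoids_between a (a + m) v \<longleftrightarrow> avoids_between 0 m w"
proof
  assume av: "avoids_between a (a + m) v"
  show "avoids_between 0 m w"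
    unfolding avoids_between_def
  proof (intro notI, elim exE conjE)
    fix i j k l
    assume "0 < i" "i < j" "j < k" "k < l" "l \<le> m" "w j < w i" "w i < w l" "w l < w k"
    then show False
      using avoids_betweenD[OF av, of "i + a" "j + a" "k + a" "l + a"] by (simp add: assms)
  qed
next
  assume av: "avoids_between 0 m w"
  show "avoids_between a (a + m) v"
    unfolding avoids_between_def
  proof (intro notI, elim exE conjE)
    fix i j k l
    assume *: "a < i" "i < j" "j < k" "k < l" "l \<le> a + m" "v j < v i" "v i < v l" "v l < v k"
    then have "v x = w (x - a) + a" if "x \<in> {i, j, k, l}" for x
      using assms[of "x - a"] that by auto
    moreover have "0 < i - a" "i - a < j - a" "j - a < k - a" "k - a < l - a" "l - a \<le> m"
      using * by linarith+
    ultimately show False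
      using avoids_betweenD[OF av, of "i - a" "j - a" "k - a" "l - a"] * by simp
  qed
qed

lemma avoids_between_cong:
  assumes "\<And>x. a < x \<Longrightarrow> x \<le> b \<Longrightarrow> v x = w x"
  shows "avoids_between a b v \<longleftrightarrow> avoids_between a b w"
proof -
  have "avoids_between a b w" if "avoids_between a b v" "\<And>x. a < x \<Longrightarrow> x \<le> b \<Longrightarrow> v x = w x" for v w
    unfolding avoids_between_def
  proof (intro notI, elim exE conjE)
    fix i j k l
    assume "a < i" "i < j" "j < k" "k < l" "l \<le> b" "w j < w i" "w i < w l" "w l < w k"
    then show False
      using avoids_betweenD[OF that(1), of i j k l] that(2) by simp
  qed
  from this[of v w] this[of w v] assms show ?thesis
    by auto
qed

lemma card_avoiders:
  "card (avoiders a (a + m)) = card {w. w permutes {1..m} \<and> avoids_2143 m w}"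
proof -
  define down where "down v x = v (x + a) - a" for v :: "nat \<Rightarrow> nat" and x
  define up where "up w x = (if x \<le> a then x else w (x - a) + a)" for w :: "nat \<Rightarrow> nat" and x
  have down: "v (x + a) = down v x + a" if v: "v permutes {a<..a + m}" for v x
  proof -
    have "a \<le> v (x + a)"
      using permutes_not_in[OF v, of "x + a"] permutes_in_image[OF v, of "x + a"]
      by (cases "x + a \<in> {a<..a + m}") auto
    then show ?thesis
      by (simp add: down_def)
  qed
  have down_perm: "down v permutes {1..m}" if v: "v permutes {a<..a + m}" for v
  proof (rule inj_imp_permutes)
    show "inj_on (down v) {1..m}"
    proof (rule inj_onI)
      fix x y assume "down v x = down v y"
      then have "v (x + a) = v (y + a)"
        by (simp add: down[OF v])
      then show "x = y"
        using permutes_inj[OF v] by (simp add: inj_eq)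
    qed
    show "down v x \<in> {1..m}" if "x \<in> {1..m}" for x
      using that down[OF v, of x] permutes_in_image[OF v, of "x + a"] by auto
    show "down v x = x" if "x \<notin> {1..m}" for x
      using that permutes_not_in[OF v, of "x + a"] by (auto simp: down_def)
  qed simp
  have up_perm: "up w permutes {a<..a + m}" if w: "w permutes {1..m}" for w
  proof (rule inj_imp_permutes)
    show "inj_on (up w) {a<..a + m}"
    proof (rule inj_onI)
      fix x y assume "x \<in> {a<..a + m}" "y \<in> {a<..a + m}" "up w x = up w y"
      then have "w (x - a) = w (y - a)" "a < x" "a < y"
        by (auto simp: up_def)
      then have "x - a = y - a"
        using permutes_inj[OF w] by (simp add: inj_eq)
      then show "x = y"
        using \<open>a < x\<close> \<open>a < y\<close> by linarith
    qed
    show "up w x \<in> {a<..a + m}" if "x \<in> {a<..a + m}" for x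
      using that permutes_in_image[OF w, of "x - a"] by (auto simp: up_def)
    show "up w x = x" if "x \<notin> {a<..a + m}" for x
    proof (cases "x \<le> a")
      case False
      then have "x - a \<notin> {1..m}"
        using that by auto
      then show ?thesis
        using False permutes_not_in[OF w] by (simp add: up_def)
    qed (simp add: up_def)
  qed simp
  have up: "up w (x + a) = w x + a" if w: "w permutes {1..m}" for w x
    using permutes_not_in[OF w, of 0] by (cases "x = 0") (auto simp: up_def)
  have avoid_down: "avoids_between a (a + m) v \<longleftrightarrow> avoids_between 0 m (down v)"
    if "v permutes {a<..a + m}" for v
    by (rule avoids_between_shift) (rule down[OF that])
  have avoid_up: "avoids_between a (a + m) (up w) \<longleftrightarrow> avoids_between 0 m w"
    if "w permutes {1..m}" for w
    by (rule avoids_between_shift) (rule up[OF that])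
  have "bij_betw down (avoiders a (a + m)) {w. w permutes {1..m} \<and> avoids_2143 m w}"
  proof (rule bij_betw_byWitness[where f' = up])
    show "\<forall>v\<in>avoiders a (a + m). up (down v) = v"
    proof (intro ballI ext)
      fix v x assume "v \<in> avoiders a (a + m)"
      then have v: "v permutes {a<..a + m}"
        by (simp add: avoiders_def)
      show "up (down v) x = v x"
        using permutes_not_in[OF v, of x] down[OF v, of "x - a"] by (auto simp: up_def)
    qed
    show "\<forall>w\<in>{w. w permutes {1..m} \<and> avoids_2143 m w}. down (up w) = w"
      using up by (auto simp: down_def)
    show "down ` avoiders a (a + m) \<subseteq> {w. w permutes {1..m} \<and> avoids_2143 m w}"
      using down_perm avoid_down
      by (auto simp: avoiders_def avoids_2143_iff)
    show "up ` {w. w permutes {1..m} \<and> avoids_2143 m w} \<subseteq> avoiders a (a + m)"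
      using up_perm avoid_up
      by (auto simp: avoiders_def avoids_2143_iff)
  qed
  then show ?thesis
    by (rule bij_betw_same_card)
qed

lemma comp_block_eq:
  fixes k m n :: nat
  assumes "u permutes {0<..k}" "v permutes {m<..n}" "k \<le> m"
  shows "(u \<circ> v) x = (if x \<le> m then u x else v x)"
proof -
  have "v x = x" if "x \<le> m"
    using that by (simp add: permutes_not_in[OF assms(2)])
  moreover have "m < v x" if "\<not> x \<le> m"
    using that permutes_not_in[OF assms(2), of x] permutes_in_image[OF assms(2), of x]
    by (cases "x \<in> {m<..n}") auto
  moreover have "u y = y" if "m < y" for y
    using that assms(3) by (simp add: permutes_not_in[OF assms(1)])
  ultimately show ?thesis
    by auto
qed

text \<open>These permutations are the sums \<open>u \<oplus> 1 \<oplus> \<dots> \<oplus> 1 \<oplus> v\<close> with \<open>m - k\<close> fixed points in the middle, and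
  \<open>(u, v)\<close> is recovered by restriction. Taking \<open>m = k\<close> marks one split of a permutation, and \<open>m = k + 1\<close> marks two
  consecutive splits.\<close>

lemma card_block_sums:
  assumes "k \<le> m" "m \<le> n"
  shows "card {w. w permutes {1..n} \<and> is_cut w k \<and> is_cut w m \<and> (\<forall>x. k < x \<and> x \<le> m \<longrightarrow> w x = x) \<and>
      avoids_between 0 k w \<and> avoids_between m n w} = card (avoiders 0 k) * card (avoiders m n)"
    (is "card ?W = _")
proof -
  define parts where "parts w = (restrict_id w {0<..k}, restrict_id w {m<..n})" for w :: "nat \<Rightarrow> nat"
  have sum: "(\<lambda>(u, v). u \<circ> v) (u, v) \<in> ?W \<and> parts ((\<lambda>(u, v). u \<circ> v) (u, v)) = (u, v)"
    if uv: "u \<in> avoiders 0 k" "v \<in> avoiders m n" for u v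
  proof -
    have u: "u permutes {0<..k}" and v: "v permutes {m<..n}"
      using uv by (auto simp: avoiders_def)
    note eq = comp_block_eq[OF u v assms(1)]
    have u_le: "u x \<le> k \<longleftrightarrow> x \<le> k" for x
      using permutes_not_in[OF u, of x] permutes_in_image[OF u, of x] by (cases "x \<in> {0<..k}") auto
    have v_gt: "m < v x \<longleftrightarrow> m < x" for x
      using permutes_not_in[OF v, of x] permutes_in_image[OF v, of x] by (cases "x \<in> {m<..n}") auto
    have u_id: "u x = x" if "k < x" for x
      using that by (simp add: permutes_not_in[OF u])
    have v_id: "v x = x" if "x \<le> m" for x
      using that by (simp add: permutes_not_in[OF v])
    have le_k: "(u \<circ> v) x \<le> k \<longleftrightarrow> x \<le> k" for x
      using u_le[of x] v_gt[of x] assms unfolding eq by auto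
    have le_m: "(u \<circ> v) x \<le> m \<longleftrightarrow> x \<le> m" for x
    proof (cases "x \<le> k")
      case True
      then show ?thesis
        using u_le[of x] assms unfolding eq by auto
    next
      case False
      then show ?thesis
        using u_id[of x] v_gt[of x] unfolding eq by auto
    qed
    have cutI: "is_cut (u \<circ> v) c" if "\<And>x. (u \<circ> v) x \<le> c \<longleftrightarrow> x \<le> c" for c
      unfolding is_cut_def using that by (meson le_less_trans not_le)
    have "u permutes {1..n}" "v permutes {1..n}"
      by (rule permutes_subset[OF u], use assms in auto) (rule permutes_subset[OF v], auto)
    then have "(u \<circ> v) permutes {1..n}"
      by (simp add: permutes_compose)
    moreover have "avoids_between 0 k (u \<circ> v)"
      using uv(1) avoids_between_cong[of 0 k "u \<circ> v" u] assms by (simp add: eq avoiders_def del: o_apply)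
    moreover have "avoids_between m n (u \<circ> v)"
      using uv(2) avoids_between_cong[of m n "u \<circ> v" v] by (simp add: eq avoiders_def del: o_apply)
    moreover have "(u \<circ> v) x = x" if "k < x" "x \<le> m" for x
      using that u_id unfolding eq by simp
    ultimately have "u \<circ> v \<in> ?W"
      using cutI[OF le_k] cutI[OF le_m] by blast
    moreover have "restrict_id (u \<circ> v) {0<..k} = u"
    proof
      fix x show "restrict_id (u \<circ> v) {0<..k} x = u x"
        using eq[of x] assms permutes_not_in[OF u, of x] by (cases "x \<in> {0<..k}") auto
    qed
    moreover have "restrict_id (u \<circ> v) {m<..n} = v"
    proof
      fix x show "restrict_id (u \<circ> v) {m<..n} x = v x"
        using eq[of x] permutes_not_in[OF v, of x] by (cases "x \<in> {m<..n}") auto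
    qed
    ultimately show ?thesis
      unfolding parts_def by simp
  qed
  have split: "parts w \<in> avoiders 0 k \<times> avoiders m n \<and> (\<lambda>(u, v). u \<circ> v) (parts w) = w"
    if w: "w \<in> ?W" for w
  proof -
    have perm: "w permutes {1..n}" and cuts: "is_cut w k" "is_cut w m"
      and mid: "\<And>x. k < x \<Longrightarrow> x \<le> m \<Longrightarrow> w x = x"
      using w by auto
    note bij = permutes_bij[OF perm]
    have bij_on: "bij_betw w A A" if "\<And>x. w x \<in> A \<longleftrightarrow> x \<in> A" for A
    proof -
      have "A \<subseteq> w ` A"
      proof
        fix y assume "y \<in> A"
        then have "y = w (inv w y)" "inv w y \<in> A"
          using that[of "inv w y"] permutes_inverses(1)[OF perm] by auto
        then show "y \<in> w ` A"
          by blast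
      qed
      then have "w ` A = A"
        using that by auto
      then show ?thesis
        using bij by (simp add: bij_betw_def bij_is_inj[THEN inj_on_subset])
    qed
    have pos: "0 < w x \<longleftrightarrow> 0 < x" for x
      using is_cut_le_iff[OF bij is_cut_0[OF perm], of x] by auto
    have le_n: "w x \<le> n \<longleftrightarrow> x \<le> n" for x
      using is_cut_le_iff[OF bij is_cut_n[OF perm], of x] .
    have gt_m: "m < w x \<longleftrightarrow> m < x" for x
      using is_cut_le_iff[OF bij cuts(2), of x] by linarith
    have "bij_betw w {0<..k} {0<..k}"
      by (rule bij_on) (simp add: pos is_cut_le_iff[OF bij cuts(1)])
    moreover have "bij_betw w {m<..n} {m<..n}"
      by (rule bij_on) (simp add: gt_m le_n)
    ultimately have u: "restrict_id w {0<..k} permutes {0<..k}" and v: "restrict_id w {m<..n} permutes {m<..n}"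
      by (auto intro: permutes_restrict_id)
    have "avoids_between 0 k (restrict_id w {0<..k})" "avoids_between m n (restrict_id w {m<..n})"
      using w avoids_between_cong[of 0 k "restrict_id w {0<..k}" w]
        avoids_between_cong[of m n "restrict_id w {m<..n}" w] by auto
    moreover have "restrict_id w {0<..k} \<circ> restrict_id w {m<..n} = w"
    proof
      fix x
      have "w 0 = 0"
        using pos[of 0] by simp
      then show "(restrict_id w {0<..k} \<circ> restrict_id w {m<..n}) x = w x"
        unfolding comp_block_eq[OF u v assms(1)]
        using mid[of x] permutes_not_in[OF perm, of x] assms by (auto simp: restrict_id_def)
    qed
    ultimately show ?thesis
      using u v unfolding parts_def avoiders_def by auto
  qed
  have "bij_betw (\<lambda>(u, v). u \<circ> v) (avoiders 0 k \<times> avoiders m n) ?W"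
    by (rule bij_betw_byWitness[where f' = parts]) (use sum split in blast)+
  from bij_betw_same_card[OF this] show ?thesis
    by (simp only: card_cartesian_product)
qed

lemma card_one_split:
  assumes "k \<le> n"
  shows "card {w. w permutes {1..n} \<and> k \<in> splits n w} = card (avoiders 0 k) * card (avoiders k n)"
proof -
  have "{w. w permutes {1..n} \<and> k \<in> splits n w} =
      {w. w permutes {1..n} \<and> is_cut w k \<and> is_cut w k \<and> (\<forall>x. k < x \<and> x \<le> k \<longrightarrow> w x = x) \<and>
        avoids_between 0 k w \<and> avoids_between k n w}"
    using assms unfolding splits_def by auto
  then show ?thesis
    using card_block_sums[of k k n] assms by simp
qed

text \<open>Two consecutive cuts \<open>k\<close> and \<open>k + 1\<close> enclose a fixed point, which is larger than
  everything before it and smaller than everything after it. The pattern 2143 neither begins with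
  its smallest entry nor ends with its largest, so attaching the fixed point to the end of the first
  block or to the beginning of the second creates no occurrence.\<close>

lemma card_two_splits:
  assumes "k < n"
  shows "card {w. w permutes {1..n} \<and> k \<in> splits n w \<and> Suc k \<in> splits n w} =
    card (avoiders 0 k) * card (avoiders (Suc k) n)"
proof -
  have "(k \<in> splits n w \<and> Suc k \<in> splits n w) \<longleftrightarrow>
      is_cut w k \<and> is_cut w (Suc k) \<and> (\<forall>x. k < x \<and> x \<le> Suc k \<longrightarrow> w x = x) \<and>
        avoids_between 0 k w \<and> avoids_between (Suc k) n w" (is "?L \<longleftrightarrow> ?R")
    if w: "w permutes {1..n}" for w
  proof
    assume L: ?L
    have "w x = x" if "k < x" "x \<le> Suc k" for x
    proof -
      have "w x \<le> k \<longleftrightarrow> x \<le> k" "w x \<le> Suc k \<longleftrightarrow> x \<le> Suc k"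
        using is_cut_le_iff[OF permutes_bij[OF w]] L unfolding splits_def by blast+
      with that show ?thesis
        by linarith
    qed
    with L show ?R
      unfolding splits_def by auto
  next
    assume R: ?R
    have "avoids_between 0 (Suc k) w"
      unfolding avoids_between_def
    proof (intro notI, elim exE conjE)
      fix p q r s
      assume *: "0 < p" "p < q" "q < r" "r < s" "s \<le> Suc k" "w q < w p" "w p < w s" "w s < w r"
      then have "r \<le> k"
        by simp
      then have "s \<noteq> Suc k"
        using R *(8) unfolding is_cut_def by (meson lessI less_asym)
      then show False
        using R * avoids_betweenD[of 0 k w p q r s] by simp
    qed
    moreover have "avoids_between k n w"
      unfolding avoids_between_def
    proof (intro notI, elim exE conjE)
      fix p q r s
      assume *: "k < p" "p < q" "q < r" "r < s" "s \<le> n" "w q < w p" "w p < w s" "w s < w r"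
      then have "Suc k < q"
        by simp
      then have "p \<noteq> Suc k"
        using R *(6) unfolding is_cut_def by (meson le_refl less_asym)
      then show False
        using R * avoids_betweenD[of "Suc k" n w p q r s] by simp
    qed
    ultimately show ?L
      using R assms unfolding splits_def by simp
  qed
  then have "{w. w permutes {1..n} \<and> k \<in> splits n w \<and> Suc k \<in> splits n w} =
      {w. w permutes {1..n} \<and> is_cut w k \<and> is_cut w (Suc k) \<and>
        (\<forall>x. k < x \<and> x \<le> Suc k \<longrightarrow> w x = x) \<and> avoids_between 0 k w \<and> avoids_between (Suc k) n w}"
    by blast
  then show ?thesis
    using card_block_sums[of k "Suc k" n] assms by simp
qed


section \<open>The number of runs of splits\<close>

lemma eq_id_if_all_cuts:
  assumes w: "w permutes {1..n}" and cuts: "\<And>k. k \<le> n \<Longrightarrow> is_cut w k"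
  shows "w = id"
proof
  fix x
  show "w x = id x"
  proof (cases "x \<in> {1..n}")
    case True
    then have "x \<le> n" "x - 1 \<le> n" "\<not> x \<le> x - 1"
      by auto
    then have "w x \<le> x" "\<not> w x \<le> x - 1"
      using is_cut_le_iff[OF permutes_bij[OF w] cuts, of x x]
        is_cut_le_iff[OF permutes_bij[OF w] cuts, of "x - 1" x] by auto
    then show ?thesis
      by simp
  qed (use permutes_not_in[OF w] in simp)
qed

lemma splits_if_avoids:
  assumes "avoids_2143 n w"
  shows "splits n w = {k. k \<le> n \<and> is_cut w k}"
  using assms avoids_between_mono[of 0 n w] unfolding splits_def avoids_2143_iff by auto

text \<open>An occurrence of 2143 in \<open>w\<close> must have its first inversion to the left of two given splits
  and its second to their right. An inversion between the splits would form another occurrence with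
  the first one, left of the second split. So there is none, and all places between are cuts.\<close>

lemma splits_convex:
  assumes w: "w permutes {1..n}" and pat: "\<not> avoids_2143 n w"
    and s: "k \<in> splits n w" "k' \<in> splits n w" "k \<le> m" "m \<le> k'"
  shows "m \<in> splits n w"
proof -
  have cut: "is_cut w k" "is_cut w k'" and av: "avoids_between 0 k' w" "avoids_between k n w"
    and "k' \<le> n"
    using s unfolding splits_def by auto
  obtain p q r t where *: "0 < p" "p < q" "q < r" "r < t" "t \<le> n" "w q < w p" "w p < w t" "w t < w r"
    using pat unfolding avoids_2143_iff avoids_between_def by blast
  have "q \<le> k"
    using is_cut_no_crossing[OF cut(1), of p q] avoids_betweenD[OF av(2), of p q r t] * by blast
  have "is_cut w m"
  proof (rule ccontr)
    assume "\<not> is_cut w m"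
    then obtain i j where ij: "i \<le> m" "m < j" "inversion w i j"
      using not_is_cutE[OF permutes_inj[OF w]] by metis
    then have "k < i" "j \<le> k'"
      using is_cut_no_crossing[OF cut(1) ij(3)] is_cut_no_crossing[OF cut(2) ij(3)] s(3,4) by auto
    moreover have "w p < w j"
      using cut(1) \<open>q \<le> k\<close> *(2) \<open>k < i\<close> ij unfolding is_cut_def
      by (meson less_imp_le less_trans order_trans)
    ultimately show False
      using avoids_betweenD[OF av(1), of p q i j] * ij(3) \<open>q \<le> k\<close> by linarith
  qed
  moreover have "avoids_between 0 m w" "avoids_between m n w"
    using avoids_between_mono[OF av(1)] avoids_between_mono[OF av(2)] s by auto
  ultimately show ?thesis
    using s \<open>k' \<le> n\<close> unfolding splits_def by auto
qed

text \<open>A 2143-avoiding permutation other than the identity has all its inversions inside one block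
  without cuts, preceded and followed by fixed points: hence two runs.\<close>

lemma split_run_ends_nonidentity:
  assumes w: "w permutes {1..n}" and av: "avoids_2143 n w" and "w \<noteq> id"
  shows "card {k \<in> splits n w. Suc k \<notin> splits n w} = 2"
proof -
  note splits = splits_if_avoids[OF av]
  have ex: "\<exists>k. \<not> is_cut w (Suc k)"
  proof (rule ccontr)
    assume "\<nexists>k. \<not> is_cut w (Suc k)"
    then have "is_cut w k" for k
      using is_cut_0[OF w] by (cases k) auto
    then show False
      using eq_id_if_all_cuts[OF w] assms(3) by blast
  qed
  \<comment> \<open>The first run of splits is \<open>0, \<dots>, a\<close>, and some inversion starts at position \<open>a + 1\<close>. A run ending
    strictly between \<open>a\<close> and \<open>n\<close> would be followed by another inversion, which forms 2143 with it.\<close>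
  define a where "a = (LEAST k. \<not> is_cut w (Suc k))"
  have na: "\<not> is_cut w (Suc a)"
    using LeastI_ex[OF ex] unfolding a_def .
  have least: "is_cut w (Suc k)" if "k < a" for k
    using not_less_Least that unfolding a_def by blast
  then have cut: "is_cut w a"
    using is_cut_0[OF w] by (cases a) auto
  obtain i j where ij: "i \<le> Suc a" "Suc a < j" "inversion w i j"
    using not_is_cutE[OF permutes_inj[OF w] na] by metis
  then have i: "i = Suc a"
    using is_cut_no_crossing[OF cut ij(3)] by linarith
  then have "a < n"
    using inversion_range[OF w ij(3)] ij(2) by linarith
  have "k = a \<or> k = n" if k: "k \<in> splits n w" "Suc k \<notin> splits n w" for k
  proof (rule ccontr)
    assume neq: "\<not> (k = a \<or> k = n)"
    then have cut_k: "is_cut w k" "k < n" "\<not> is_cut w (Suc k)"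
      using k unfolding splits by auto
    then have "a < k"
      using least[of k] neq by fastforce
    obtain p q where pq: "p \<le> Suc k" "Suc k < q" "inversion w p q"
      using not_is_cutE[OF permutes_inj[OF w] cut_k(3)] by metis
    then have "k < p"
      using is_cut_no_crossing[OF cut_k(1) pq(3)] by linarith
    moreover have "j \<le> k"
      using is_cut_no_crossing[OF cut_k(1) ij(3)] i \<open>a < k\<close> by linarith
    moreover have "w i < w q"
      using cut_k(1) i \<open>a < k\<close> pq(2) unfolding is_cut_def by (meson Suc_leI Suc_lessD)
    ultimately show False
      using avoids_betweenD[OF av[unfolded avoids_2143_iff], of i j p q] ij i pq
        inversion_range[OF w pq(3)] by linarith
  qed
  then have "{k \<in> splits n w. Suc k \<notin> splits n w} = {a, n}"
    using cut na \<open>a < n\<close> is_cut_n[OF w] unfolding splits by auto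
  then show ?thesis
    using \<open>a < n\<close> by simp
qed

text \<open>Runs of consecutive splits are counted by their last elements.\<close>

lemma card_split_run_ends:
  assumes w: "w permutes {1..n}"
  shows "card {k \<in> splits n w. Suc k \<notin> splits n w} + of_bool (w = id) =
    of_bool (skew_vexillary n w) + of_bool (avoids_2143 n w)"
proof (cases "avoids_2143 n w")
  case True
  have "0 \<in> splits n w"
    using is_cut_0[OF w] splits_if_avoids[OF True] by simp
  then have sv: "skew_vexillary n w"
    using skew_vexillary_iff_splits[OF w] by blast
  show ?thesis
  proof (cases "w = id")
    case True
    then have "splits n w = {..n}"
      using splits_if_avoids[OF \<open>avoids_2143 n w\<close>] by (auto simp: is_cut_def)
    then have "{k \<in> splits n w. Suc k \<notin> splits n w} = {n}"
      by auto
    then show ?thesis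
      using \<open>avoids_2143 n w\<close> sv True by simp
  next
    case False
    then show ?thesis
      using split_run_ends_nonidentity[OF w True] True sv by simp
  qed
next
  case False
  have "w \<noteq> id"
  proof
    assume "w = id"
    then have "avoids_2143 n w"
      unfolding avoids_2143_iff avoids_between_def by auto
    with False show False ..
  qed
  show ?thesis
  proof (cases "splits n w = {}")
    case True
    then show ?thesis
      using False \<open>w \<noteq> id\<close> skew_vexillary_iff_splits[OF w] by simp
  next
    case ne: False
    have "splits n w \<subseteq> {..n}"
      unfolding splits_def by auto
    then have fin: "finite (splits n w)"
      using finite_subset by blast
    have "{k \<in> splits n w. Suc k \<notin> splits n w} = {Max (splits n w)}"
    proof (intro equalityI subsetI)
      fix k assume k: "k \<in> {k \<in> splits n w. Suc k \<notin> splits n w}"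
      have "\<not> k < Max (splits n w)"
        using splits_convex[OF w False _ Max_in[OF fin ne], of k "Suc k"] k by auto
      then show "k \<in> {Max (splits n w)}"
        using Max_ge[OF fin, of k] k by auto
    next
      fix k assume "k \<in> {Max (splits n w)}"
      then show "k \<in> {k \<in> splits n w. Suc k \<notin> splits n w}"
        using Max_in[OF fin ne] Max_ge[OF fin, of "Suc k"] by auto
    qed
    then show ?thesis
      using False \<open>w \<noteq> id\<close> ne skew_vexillary_iff_splits[OF w] by simp
  qed
qed


section \<open>The generating function\<close>

lemma sum_card_eq_sum_card:
  assumes "finite A" "finite B"
  shows "(\<Sum>x\<in>A. card {y \<in> B. R x y}) = (\<Sum>y\<in>B. card {x \<in> A. R x y})"
  using sum.swap_restrict[OF assms, of "\<lambda>_ _. 1::nat" R] by simp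

text \<open>Sum the number of run ends over all permutations: it is the number of splits minus
  the number of pairs of consecutive splits. The summand \<open>1\<close> on the right is the identity.\<close>

lemma skew_vexillary_count:
  fixes n :: nat
  defines "c \<equiv> \<lambda>m. card {w. w permutes {1..m} \<and> avoids_2143 m w}"
  shows "card {w. w permutes {1..n} \<and> skew_vexillary n w} + c n + (\<Sum>k<n. c k * c (n - Suc k))
    = (\<Sum>k\<le>n. c k * c (n - k)) + 1"
proof -
  define P where "P = {w. w permutes {1..n}}"
  have fin: "finite P"
    unfolding P_def by (simp add: finite_permutations)
  have c: "card (avoiders a b) = c (b - a)" if "a \<le> b" for a b
    using card_avoiders[of a "b - a"] that unfolding c_def by simp
  have le: "splits n w \<subseteq> {..n}" for w
    unfolding splits_def by auto
  have runs: "card (splits n w) = card {k \<in> splits n w. Suc k \<notin> splits n w} +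
      card {k \<in> {..<n}. k \<in> splits n w \<and> Suc k \<in> splits n w}" for w
  proof -
    have "splits n w = {k \<in> splits n w. Suc k \<notin> splits n w} \<union>
        {k \<in> {..<n}. k \<in> splits n w \<and> Suc k \<in> splits n w}"
      using le[of w] by auto
    moreover have "finite (splits n w)"
      using le finite_subset by blast
    ultimately show ?thesis
      by (subst card_Un_disjoint[symmetric]) auto
  qed
  have one: "(\<Sum>w\<in>P. card (splits n w)) = (\<Sum>k\<le>n. c k * c (n - k))"
  proof -
    have "(\<Sum>w\<in>P. card (splits n w)) = (\<Sum>w\<in>P. card {k \<in> {..n}. k \<in> splits n w})"
      using le by (intro sum.cong refl arg_cong[where f = card]) auto
    also have "\<dots> = (\<Sum>k\<le>n. card {w \<in> P. k \<in> splits n w})"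
      by (rule sum_card_eq_sum_card) (use fin in auto)
    also have "\<dots> = (\<Sum>k\<le>n. c k * c (n - k))"
      by (rule sum.cong) (auto simp: P_def card_one_split c simp del: One_nat_def)
    finally show ?thesis .
  qed
  have two: "(\<Sum>w\<in>P. card {k \<in> {..<n}. k \<in> splits n w \<and> Suc k \<in> splits n w}) =
      (\<Sum>k<n. c k * c (n - Suc k))"
  proof -
    have "(\<Sum>w\<in>P. card {k \<in> {..<n}. k \<in> splits n w \<and> Suc k \<in> splits n w}) =
        (\<Sum>k<n. card {w \<in> P. k \<in> splits n w \<and> Suc k \<in> splits n w})"
      by (rule sum_card_eq_sum_card) (use fin in auto)
    also have "\<dots> = (\<Sum>k<n. c k * c (n - Suc k))"
      by (rule sum.cong) (auto simp: P_def card_two_splits c simp del: One_nat_def)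
    finally show ?thesis .
  qed
  have count: "(\<Sum>w\<in>P. of_bool (Q w)) = card {w. w permutes {1..n} \<and> Q w}" for Q
    using fin by (simp add: sum_of_bool_eq P_def Collect_conj_eq)
  have "{w. w permutes {1..n} \<and> w = id} = {id}"
    by auto
  then have "(\<Sum>w\<in>P. of_bool (w = id)) = (1::nat)"
    unfolding count by simp
  then have "(\<Sum>w\<in>P. card (splits n w)) + 1 =
      (\<Sum>w\<in>P. card {k \<in> splits n w. Suc k \<notin> splits n w} + of_bool (w = id)) +
      (\<Sum>w\<in>P. card {k \<in> {..<n}. k \<in> splits n w \<and> Suc k \<in> splits n w})"
    by (simp add: runs sum.distrib)
  also have "(\<Sum>w\<in>P. card {k \<in> splits n w. Suc k \<notin> splits n w} + of_bool (w = id)) =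
      (\<Sum>w\<in>P. of_bool (skew_vexillary n w) + of_bool (avoids_2143 n w))"
    by (rule sum.cong) (auto simp only: P_def mem_Collect_eq card_split_run_ends)
  also have "\<dots> = card {w. w permutes {1..n} \<and> skew_vexillary n w} + c n"
    unfolding sum.distrib count c_def ..
  finally show ?thesis
    unfolding one two by simp
qed

theorem theorem5p8:
  fixes V SV :: "rat fps"
  assumes "V = perm_class_ogf avoids_2143"
    and "SV = perm_class_ogf skew_vexillary"
  shows "SV = (1 - fps_X) * V ^ 2 - V + 1 / (1 - fps_X)"
proof (rule fps_ext)
  fix n
  define c where "c m = card {w. w permutes {1..m} \<and> avoids_2143 m w}" for m
  have V: "fps_nth V m = of_nat (c m)" for m
    unfolding assms(1) perm_class_ogf_def c_def by simp
  have SV: "fps_nth SV n = of_nat (card {w. w permutes {1..n} \<and> skew_vexillary n w})"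
    unfolding assms(2) perm_class_ogf_def by simp
  have square: "fps_nth (V ^ 2) m = of_nat (\<Sum>k\<le>m. c k * c (m - k))" for m
    by (simp add: power2_eq_square fps_mult_nth V atMost_atLeast0)
  have shifted: "fps_nth (fps_X * V ^ 2) n = of_nat (\<Sum>k<n. c k * c (n - Suc k))"
    by (cases n) (simp_all add: square lessThan_Suc_atMost del: of_nat_sum)
  have geometric: "fps_nth (1 / (1 - fps_X) :: rat fps) n = 1"
    using gp[of "fps_X :: rat fps"] by (simp flip: gp)
  have "fps_nth SV n + of_nat (c n) + of_nat (\<Sum>k<n. c k * c (n - Suc k)) =
      of_nat (\<Sum>k\<le>n. c k * c (n - k)) + 1"
    using arg_cong[OF skew_vexillary_count[of n], of "of_nat :: nat \<Rightarrow> rat"]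
    unfolding SV c_def by simp
  moreover have "fps_nth ((1 - fps_X) * V ^ 2 - V + 1 / (1 - fps_X)) n =
      fps_nth (V ^ 2) n - fps_nth (fps_X * V ^ 2) n - fps_nth V n + 1"
    by (simp only: left_diff_distrib mult_1 fps_sub_nth fps_add_nth geometric)
  ultimately show "fps_nth SV n = fps_nth ((1 - fps_X) * V ^ 2 - V + 1 / (1 - fps_X)) n"
    unfolding square shifted V by linarith
qed

end
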